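(* Let $(A,\cdot_A,[-,-]_A)$ be an $F$-manifold algebra and $\alpha:A\to A$ an average operator on $A$. Define new operations on $A$ by $$x\bullet y=\alpha(x)\cdot_A y,\qquad \{x,y\}=[\alpha(x),y]_A,\qquad\forall\,x,y\in A.$$ Then $(A,\bullet,\{-,-\})$ is a dual pre-$F$-manifold algebra.
   Context: All vector spaces are finite dimensional over an algebraically closed field $\mathbb{K}$ of characteristic $0$. An $F$-manifold algebra is a triple $(A,\cdot_A,[-,-]_A)$ where $(A,\cdot_A)$ is a commutative associative algebra and $(A,[-,-]_A)$ is a Lie algebra such that $P_{x\cdot_A y}(z,w)=x\cdot_A P_y(z,w)+y\cdot_A P_x(z,w)$ for all $x,y,z,w\in A$, where $P_x(y,z)=[x,y\cdot_A z]_A-[x,y]_A\cdot_A z-y\cdot_A[x,z]_A$. An average operator on an $F$-manifold algebra $A$ is a linear map $\alpha:A\to A$ with $\alpha(x)\cdot_A\alpha(y)=\alpha(\alpha(x)\cdot_A y)$ and $[\alpha(x),\alpha(y)]_A=\alpha([\alpha(x),y]_A)$ for all $x,y\in A$. A permutative algebra is a vector space with a bilinear product $\bullet$ with $x\bullet(y\bullet z)=(x\bullet y)\bullet z=(y\bullet x)\bullet z$. A Leibniz algebra is a vector space with a bilinear bracket with $\{x,\{y,z\}\}=\{\{x,y\},z\}+\{y,\{x,z\}\}$. A dual pre-$F$-manifold algebra is a triple $(A,\bullet,\{-,-\})$ with $(A,\bullet)$ a permutative algebra and $(A,\{-,-\})$ a Leibniz algebra such that for all $x,y,z,w\in A$: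 $$G_1(x\bullet y,z,w)=x\bullet G_1(y,z,w)+y\bullet G_1(x,z,w),$$ $$G_2(y\bullet x,z,w)=y\bullet G_2(x,z,w)-G_1(y,z,w)\bullet x,$$ $$\{x,y\}\bullet z+\{y,x\}\bullet z=0,$$ where $G_1(x,y,z)=\{x,y\bullet z\}-\{x,y\}\bullet z-y\bullet\{x,z\}$ and $G_2(x,y,z)=\{y\bullet z,x\}-z\bullet\{y,x\}-y\bullet\{z,x\}$. *)

theory Defs
  imports "HOL-Computational_Algebra.Polynomial"
begin

text \<open>
  The underlying vector space is the whole type \<open>'a\<close>, with scalar multiplication \<open>scale\<close>.
  Algebras are not assumed to be unital.
\<close>

locale fin_dim_space = vector_space scale
  for scale :: "'k::{alg_closed_field, field_char_0} \<Rightarrow> 'a::ab_group_add \<Rightarrow> 'a" +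
  assumes finite_dimensional: "\<exists>B. finite_dimensional_vector_space scale B"

locale algebra_on = fin_dim_space scale
  for scale :: "'k::{alg_closed_field, field_char_0} \<Rightarrow> 'a::ab_group_add \<Rightarrow> 'a"
    and prd :: "'a \<Rightarrow> 'a \<Rightarrow> 'a" +
  assumes linear_right: "\<And>x. Vector_Spaces.linear scale scale (\<lambda>y. prd x y)"
    and linear_left: "\<And>y. Vector_Spaces.linear scale scale (\<lambda>x. prd x y)"

locale comm_assoc_algebra = algebra_on scale mul
  for scale :: "'k::{alg_closed_field, field_char_0} \<Rightarrow> 'a::ab_group_add \<Rightarrow> 'a"
    and mul :: "'a \<Rightarrow> 'a \<Rightarrow> 'a" (infixl "\<cdot>" 70) +
  assumes comm: "x \<cdot> y = y \<cdot> x"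
    and assoc: "(x \<cdot> y) \<cdot> z = x \<cdot> (y \<cdot> z)"

locale lie_algebra = algebra_on scale bracket
  for scale :: "'k::{alg_closed_field, field_char_0} \<Rightarrow> 'a::ab_group_add \<Rightarrow> 'a"
    and bracket :: "'a \<Rightarrow> 'a \<Rightarrow> 'a" ("\<lbrakk>_, _\<rbrakk>") +
  assumes alternating: "\<lbrakk>x, x\<rbrakk> = 0"
    and jacobi: "\<lbrakk>x, \<lbrakk>y, z\<rbrakk>\<rbrakk> + \<lbrakk>y, \<lbrakk>z, x\<rbrakk>\<rbrakk> + \<lbrakk>z, \<lbrakk>x, y\<rbrakk>\<rbrakk> = 0"

text \<open>The expression usually written \<open>P\<^sub>x(y, z)\<close>.\<close>

definition leibnizator :: "('a \<Rightarrow> 'a \<Rightarrow> 'a) \<Rightarrow> ('a \<Rightarrow> 'a \<Rightarrow> 'a) \<Rightarrow> 'a \<Rightarrow> 'a \<Rightarrow> 'a \<Rightarrow> 'a::ab_group_add" where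
  "leibnizator mul bracket x y z =
     bracket x (mul y z) - mul (bracket x y) z - mul y (bracket x z)"

locale F_manifold_algebra =
  comm_assoc_algebra scale mul + lie_algebra scale bracket
  for scale :: "'k::{alg_closed_field, field_char_0} \<Rightarrow> 'a::ab_group_add \<Rightarrow> 'a"
    and mul :: "'a \<Rightarrow> 'a \<Rightarrow> 'a" (infixl "\<cdot>" 70)
    and bracket :: "'a \<Rightarrow> 'a \<Rightarrow> 'a" ("\<lbrakk>_, _\<rbrakk>") +
  assumes hertling_manin:
    "leibnizator mul bracket (x \<cdot> y) z w = x \<cdot> leibnizator mul bracket y z w + y \<cdot> leibnizator mul bracket x z w"

locale average_operator = Vector_Spaces.linear scale scale \<alpha>
  for scale :: "'k::{alg_closed_field, field_char_0} \<Rightarrow> 'a::ab_group_add \<Rightarrow> 'a"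
    and mul :: "'a \<Rightarrow> 'a \<Rightarrow> 'a" (infixl "\<cdot>" 70)
    and bracket :: "'a \<Rightarrow> 'a \<Rightarrow> 'a" ("\<lbrakk>_, _\<rbrakk>")
    and \<alpha> :: "'a \<Rightarrow> 'a" +
  assumes average_mult: "\<alpha> x \<cdot> \<alpha> y = \<alpha> (\<alpha> x \<cdot> y)"
    and average_bracket: "\<lbrakk>\<alpha> x, \<alpha> y\<rbrakk> = \<alpha> \<lbrakk>\<alpha> x, y\<rbrakk>"

locale permutative_algebra = algebra_on scale prd
  for scale :: "'k::{alg_closed_field, field_char_0} \<Rightarrow> 'a::ab_group_add \<Rightarrow> 'a"
    and prd :: "'a \<Rightarrow> 'a \<Rightarrow> 'a" (infixl "\<bullet>" 70) +
  assumes perm_assoc: "x \<bullet> (y \<bullet> z) = (x \<bullet> y) \<bullet> z"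
    and perm_comm: "(x \<bullet> y) \<bullet> z = (y \<bullet> x) \<bullet> z"

locale leibniz_algebra = algebra_on scale brace
  for scale :: "'k::{alg_closed_field, field_char_0} \<Rightarrow> 'a::ab_group_add \<Rightarrow> 'a"
    and brace :: "'a \<Rightarrow> 'a \<Rightarrow> 'a" ("\<lbrace>_, _\<rbrace>") +
  assumes leibniz: "\<lbrace>x, \<lbrace>y, z\<rbrace>\<rbrace> = \<lbrace>\<lbrace>x, y\<rbrace>, z\<rbrace> + \<lbrace>y, \<lbrace>x, z\<rbrace>\<rbrace>"

definition G1 :: "('a \<Rightarrow> 'a \<Rightarrow> 'a) \<Rightarrow> ('a \<Rightarrow> 'a \<Rightarrow> 'a) \<Rightarrow> 'a \<Rightarrow> 'a \<Rightarrow> 'a \<Rightarrow> 'a::ab_group_add" where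
  "G1 prd brace x y z =
     brace x (prd y z) - prd (brace x y) z - prd y (brace x z)"

definition G2 :: "('a \<Rightarrow> 'a \<Rightarrow> 'a) \<Rightarrow> ('a \<Rightarrow> 'a \<Rightarrow> 'a) \<Rightarrow> 'a \<Rightarrow> 'a \<Rightarrow> 'a \<Rightarrow> 'a::ab_group_add" where
  "G2 prd brace x y z =
     brace (prd y z) x - prd z (brace y x) - prd y (brace z x)"

locale dual_pre_F_manifold_algebra =
  permutative_algebra scale prd + leibniz_algebra scale brace
  for scale :: "'k::{alg_closed_field, field_char_0} \<Rightarrow> 'a::ab_group_add \<Rightarrow> 'a"
    and prd :: "'a \<Rightarrow> 'a \<Rightarrow> 'a" (infixl "\<bullet>" 70)
    and brace :: "'a \<Rightarrow> 'a \<Rightarrow> 'a" ("\<lbrace>_, _\<rbrace>") +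
  assumes G1_prd: "G1 prd brace (x \<bullet> y) z w = x \<bullet> G1 prd brace y z w + y \<bullet> G1 prd brace x z w"
    and G2_prd: "G2 prd brace (y \<bullet> x) z w = y \<bullet> G2 prd brace x z w - G1 prd brace y z w \<bullet> x"
    and brace_prd: "\<lbrace>x, y\<rbrace> \<bullet> z + \<lbrace>y, x\<rbrace> \<bullet> z = 0"

end

theory Submission
  imports Defs
begin

text \<open>
  With \<open>P\<close> the Leibnizator of the \<open>F\<close>-manifold algebra, the averaging identities give
  \<open>G\<^sub>1(x, y, z) = P(\<alpha> x; \<alpha> y, z)\<close> and \<open>G\<^sub>2(x, y, z) = - P(x; \<alpha> y, \<alpha> z)\<close>, as well as
  \<open>\<alpha> (P(\<alpha> x; \<alpha> y, z)) = P(\<alpha> x; \<alpha> y, \<alpha> z)\<close>. The identities for \<open>G\<^sub>1\<close> and \<open>G\<^sub>2\<close> are therefore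
  both instances of the Hertling--Manin relation.
\<close>

context algebra_on
begin

lemma prd_add_left: "prd (x + y) z = prd x z + prd y z"
  using linear_left[of z] by (simp add: Vector_Spaces.linear_iff)

lemma prd_add_right: "prd x (y + z) = prd x y + prd x z"
  using linear_right[of x] by (simp add: Vector_Spaces.linear_iff)

lemma prd_minus_right: "prd x (- y) = - prd x y"
  using prd_add_right[of x y "- y"] prd_add_right[of x 0 0]
  by (simp add: eq_neg_iff_add_eq_0 add.commute)

lemma prd_zero_left: "prd 0 z = 0"
  using prd_add_left[of 0 0 z] by simp

text \<open>Linearity in the left argument survives precomposition with a linear map. With
  \<open>f\<close> = \<alpha> this makes both new operations bilinear.\<close>

lemma algebra_on_twist_left:
  assumes "Vector_Spaces.linear scale scale f"
  shows "algebra_on scale (\<lambda>x y. prd (f x) y)"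
proof (intro algebra_on.intro algebra_on_axioms.intro fin_dim_space_axioms)
  show "Vector_Spaces.linear scale scale (\<lambda>y. prd (f x) y)" for x
    by (rule linear_right)
  show "Vector_Spaces.linear scale scale (\<lambda>x. prd (f x) y)" for y
    using Vector_Spaces.linear_compose[OF assms linear_left[of y]] by (simp add: o_def)
qed

end

lemmas (in comm_assoc_algebra) mul_add_left = prd_add_left
lemmas (in comm_assoc_algebra) mul_zero_left = prd_zero_left
lemmas (in comm_assoc_algebra) mul_minus_right = prd_minus_right

context lie_algebra
begin

text \<open>Polarisation: expand the vanishing bracket of \<open>x + y\<close> with itself.\<close>

lemma antisym: "\<lbrakk>x, y\<rbrakk> = - \<lbrakk>y, x\<rbrakk>"
  using alternating[of "x + y"] unfolding prd_add_left prd_add_right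
  by (simp add: alternating eq_neg_iff_add_eq_0 add.commute)

text \<open>The Jacobi identity, rearranged by antisymmetry into the form that the twisted bracket
  inherits.\<close>

lemma bracket_leibniz: "\<lbrakk>x, \<lbrakk>y, z\<rbrakk>\<rbrakk> = \<lbrakk>\<lbrakk>x, y\<rbrakk>, z\<rbrakk> + \<lbrakk>y, \<lbrakk>x, z\<rbrakk>\<rbrakk>"
proof -
  have "\<lbrakk>y, \<lbrakk>z, x\<rbrakk>\<rbrakk> = - \<lbrakk>y, \<lbrakk>x, z\<rbrakk>\<rbrakk>"
    by (metis antisym prd_minus_right)
  then show ?thesis
    using jacobi[of x y z] antisym[of z "\<lbrakk>x, y\<rbrakk>"] by (simp add: algebra_simps add_eq_0_iff)
qed

end

locale averaged_F_manifold_algebra =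
  F_manifold_algebra scale mul bracket + average_operator scale mul bracket \<alpha>
  for scale :: "'k::{alg_closed_field, field_char_0} \<Rightarrow> 'a::ab_group_add \<Rightarrow> 'a"
    and mul :: "'a \<Rightarrow> 'a \<Rightarrow> 'a" (infixl "\<cdot>" 70)
    and bracket :: "'a \<Rightarrow> 'a \<Rightarrow> 'a" ("\<lbrakk>_, _\<rbrakk>")
    and \<alpha> :: "'a \<Rightarrow> 'a"
begin

abbreviation P :: "'a \<Rightarrow> 'a \<Rightarrow> 'a \<Rightarrow> 'a" where
  "P \<equiv> leibnizator mul bracket"

abbreviation avg_mul :: "'a \<Rightarrow> 'a \<Rightarrow> 'a" (infixl "\<bullet>" 70) where
  "avg_mul \<equiv> \<lambda>x y. \<alpha> x \<cdot> y"

abbreviation avg_bracket :: "'a \<Rightarrow> 'a \<Rightarrow> 'a" ("\<lbrace>_, _\<rbrace>") where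
  "avg_bracket \<equiv> \<lambda>x y. \<lbrakk>\<alpha> x, y\<rbrakk>"

lemma G1_eq: "G1 avg_mul avg_bracket x y z = P (\<alpha> x) (\<alpha> y) z"
  by (simp add: G1_def leibnizator_def average_bracket)

text \<open>Averaging turns \<open>\<alpha> (\<alpha> y \<cdot> z)\<close> into
  \<open>\<alpha> y \<cdot> \<alpha> z\<close>; moving \<open>x\<close> to the first slot of each
  bracket then costs one sign per term.\<close>

lemma G2_eq: "G2 avg_mul avg_bracket x y z = - P x (\<alpha> y) (\<alpha> z)"
proof -
  have "\<lbrakk>\<alpha> y \<cdot> \<alpha> z, x\<rbrakk> = - \<lbrakk>x, \<alpha> y \<cdot> \<alpha> z\<rbrakk>"
    by (rule antisym)
  moreover have "\<alpha> z \<cdot> \<lbrakk>\<alpha> y, x\<rbrakk> = - (\<lbrakk>x, \<alpha> y\<rbrakk> \<cdot> \<alpha> z)"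
    by (metis antisym comm mul_minus_right)
  moreover have "\<alpha> y \<cdot> \<lbrakk>\<alpha> z, x\<rbrakk> = - (\<alpha> y \<cdot> \<lbrakk>x, \<alpha> z\<rbrakk>)"
    by (metis antisym mul_minus_right)
  ultimately show ?thesis
    by (simp add: G2_def leibnizator_def flip: average_mult)
qed

lemma average_leibnizator: "\<alpha> (P (\<alpha> x) (\<alpha> y) z) = P (\<alpha> x) (\<alpha> y) (\<alpha> z)"
proof -
  \<comment> \<open>The bracket equals \<open>\<alpha> \<lbrakk>\<alpha> x, y\<rbrakk>\<close>, so
    it lies in the image of \<alpha> and multiplicative averaging applies to it.\<close>
  have "\<alpha> (\<lbrakk>\<alpha> x, \<alpha> y\<rbrakk> \<cdot> z) = \<lbrakk>\<alpha> x, \<alpha> y\<rbrakk> \<cdot> \<alpha> z"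
    by (metis average_bracket average_mult)
  then show ?thesis
    by (simp add: leibnizator_def diff average_mult average_bracket)
qed

lemma dual_pre_F_manifold_algebra: "dual_pre_F_manifold_algebra scale avg_mul avg_bracket"
proof -
  have lin: "Vector_Spaces.linear scale scale \<alpha>"
    by unfold_locales
  \<comment> \<open>The two interpretations settle bilinearity, so only the identities remain after
    \<open>unfold_locales\<close>.\<close>
  interpret M: algebra_on scale avg_mul
    using comm_assoc_algebra.axioms(1)[OF comm_assoc_algebra_axioms] lin
    by (rule algebra_on.algebra_on_twist_left)
  interpret B: algebra_on scale avg_bracket
    using lie_algebra.axioms(1)[OF lie_algebra_axioms] lin
    by (rule algebra_on.algebra_on_twist_left)
  show ?thesis
  proof unfold_locales
    fix x y z w
    show "x \<bullet> (y \<bullet> z) = (x \<bullet> y) \<bullet> z"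
      by (simp add: assoc flip: average_mult)
    show "(x \<bullet> y) \<bullet> z = (y \<bullet> x) \<bullet> z"
      by (metis average_mult comm)
    show "\<lbrace>x, \<lbrace>y, z\<rbrace>\<rbrace> = \<lbrace>\<lbrace>x, y\<rbrace>, z\<rbrace> + \<lbrace>y, \<lbrace>x, z\<rbrace>\<rbrace>"
      using bracket_leibniz[of "\<alpha> x" "\<alpha> y" z] by (simp flip: average_bracket)
    show "G1 avg_mul avg_bracket (x \<bullet> y) z w
        = x \<bullet> G1 avg_mul avg_bracket y z w + y \<bullet> G1 avg_mul avg_bracket x z w"
      unfolding G1_eq by (simp add: hertling_manin flip: average_mult)
    \<comment> \<open>Hertling--Manin at \<open>\<alpha> y \<cdot> x\<close> produces the left side;
      the right side is \<open>G1\<close> multiplied by \<open>x\<close>, after \<alpha> has passed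
      through the Leibnizator.\<close>
    have "x \<cdot> P (\<alpha> y) (\<alpha> z) (\<alpha> w) = P (\<alpha> y) (\<alpha> z) (\<alpha> w) \<cdot> x"
      by (rule comm)
    then show "G2 avg_mul avg_bracket (y \<bullet> x) z w
        = y \<bullet> G2 avg_mul avg_bracket x z w - G1 avg_mul avg_bracket y z w \<bullet> x"
      unfolding G1_eq G2_eq average_leibnizator
      by (simp add: hertling_manin mul_minus_right)
    \<comment> \<open>The twisted bracket need not be antisymmetric, but it becomes so under
      \<alpha>, which the left factor of the twisted product supplies.\<close>
    have "\<alpha> \<lbrakk>\<alpha> x, y\<rbrakk> + \<alpha> \<lbrakk>\<alpha> y, x\<rbrakk> = 0"
      using antisym[of "\<alpha> x" "\<alpha> y"] by (simp flip: average_bracket)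
    then show "\<lbrace>x, y\<rbrace> \<bullet> z + \<lbrace>y, x\<rbrace> \<bullet> z = 0"
      by (metis mul_add_left mul_zero_left)
  qed
qed

end

theorem theorem5p5:
  fixes scale :: "'k::{alg_closed_field, field_char_0} \<Rightarrow> 'a::ab_group_add \<Rightarrow> 'a"
    and mul bracket :: "'a \<Rightarrow> 'a \<Rightarrow> 'a"
    and \<alpha> :: "'a \<Rightarrow> 'a"
  assumes "F_manifold_algebra scale mul bracket"
    and "average_operator scale mul bracket \<alpha>"
  shows "dual_pre_F_manifold_algebra scale
           (\<lambda>x y. mul (\<alpha> x) y) (\<lambda>x y. bracket (\<alpha> x) y)"
  using assms averaged_F_manifold_algebra.intro
  by (intro averaged_F_manifold_algebra.dual_pre_F_manifold_algebra)

end
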